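(* Consider Problem (P) below and suppose that, for every feasible first-stage decision $z\in\mathcal Z$ and every realization of $Y\in\mathbb R^{d_y}$, the second-stage problem $\min_\omega\{q^\top\omega: W\omega\ge T(z)Y+h(z)\}$ is feasible (relatively complete recourse) and its linear programming dual is feasible (sufficiently expensive recourse). Assume there is a solution oracle that solves the master problem (MP) to optimality, and that the subproblems (SP$^k$) are solved using a method that returns extreme points in finitely many iterations. Then the specialized Benders algorithm described below converges to an optimal solution of Problem (P) in finitely many iterations.
   Context: Data: $\mathcal Z\subseteq\mathbb R^{d_z}$ nonempty compact; a fixed covariate $x$; a (possibly nonlinear) regression estimate $z\mapsto\hat f_n(x,z)\in\mathbb R^{d_y}$; residual vectors $\hat\epsilon_n^1,\dots,\hat\epsilon_n^n\in\mathbb R^{d_y}$; a radius $\xi_n(\alpha,x)\ge0$; vectors $c_z\in\mathbb R^{d_z}$, $q\in\mathbb R^{d_\omega}$; a matrix $W\in\mathbb R^{M\times d_\omega}$; $T(z)\in\mathbb R^{M\times d_y}$ and $h(z)\in\mathbb R^M$ affine in $z$. $e_m$ is the $m$-th standard unit vector of $\mathbb R^{d_y}$, and $[n]=\{1,\dots,n\}$. Put $Y^k(x,z):=\hat f_n(x,z)+\hat\epsilon_n^k$ and $H(z,Y):=\min_\omega\{q^\top\omega:W\omega\ge T(z)Y+h(z)\}$. First-stage constraints (F) on $(z,\lambda,\phi,\psi)$: $z\in\mathcal Z$, $\lambda\ge0$, and for all $m\in[d_y]$: $\phi_m,\psi_m\in\mathbb R^{d_\omega}$, $q^\top\phi_m\le\lambda$,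 $q^\top\psi_m\le\lambda$, $T(z)e_m\le W\phi_m$, $-T(z)e_m\le W\psi_m$. Problem (P): minimize $c_z^\top z+\lambda\,\xi_n(\alpha,x)+\frac1n\sum_{k=1}^nq^\top\omega_k$ over $(z,\lambda,\phi,\psi,\omega)$ subject to (F) and $W\omega_k\ge T(z)Y^k(x,z)+h(z)$, $\omega_k\in\mathbb R^{d_\omega}$ for all $k\in[n]$. Equivalently (the form in which solutions are returned): minimize $c_z^\top z+\lambda\,\xi_n(\alpha,x)+\frac1n\sum_k\Theta_k$ over $(z,\lambda,\phi,\psi,\{\Theta_k\}_{k=1}^n)$ subject to (F) and $\Theta_k\ge H(z,Y^k(x,z))$ for all $k\in[n]$. Subproblem at $z^t$, for $k\in[n]$: (SP$^k$) $\ \Omega_k(z^t):=\max\{\pi^\top(T(z^t)Y^k(x,z^t)+h(z^t)):\pi\in\Pi\}$, with feasible region $\Pi:=\{\pi\in\mathbb R^M_+:W^\top\pi=q\}$. Master problem at iteration $t$: (MP) minimize $c_z^\top z+\lambda\,\xi_n(\alpha,x)+\frac1n\sum_k\Theta_k$ over $(z,\lambda,\phi,\psi,\{\Theta_k\})$ subject to (F) and the cuts $\Theta_k\ge(\pi^{k,\tau})^\top(T(z)(\hat f_n(x,z)+\hat\epsilon_n^k)+h(z))$ for all $k\in[n]$, $\tau\in[t-1]$. Initially ($t=1$) the cut set is empty (or consists of known bounds and cuts). Algorithm (with a pre-defined threshold $\varepsilon$ for the bound gap). Initialize $\mathrm{LB}\gets-\infty$, $\mathrm{UB}\gets+\infty$,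 $t\gets1$. While $\mathrm{UB}-\mathrm{LB}>\varepsilon$, do: (1) Solve (MP) to obtain an optimal solution $(z^t,\lambda^t,\phi^t,\psi^t,\{\Theta_k^t\}_{k=1}^n)$. (2) Set $\mathrm{LB}\gets$ the optimal value of (MP). (3) For each $k\in[n]$, evaluate $Y^k(x,z^t)=\hat f_n(x,z^t)+\hat\epsilon_n^k$, solve (SP$^k$) at $z^t$, and obtain an optimal solution $\pi^{k,t}$. (4) Set $\mathrm{UB}\gets\min\{\mathrm{UB},\ c_z^\top z^t+\lambda^t\xi_n(\alpha,x)+\frac1n\sum_{k=1}^n(\pi^{k,t})^\top(T(z^t)Y^k(x,z^t)+h(z^t))\}$. (5) If $\Theta_k^t\ge(\pi^{k,t})^\top(T(z^t)(\hat f_n(x,z^t)+\hat\epsilon_n^k)+h(z^t))$ for all $k\in[n]$, return $(z^t,\lambda^t,\phi^t,\psi^t,\{\Theta_k^t\}_{k=1}^n)$. Otherwise add the cuts $\Theta_k\ge(\pi^{k,t})^\top(T(z)(\hat f_n(x,z)+\hat\epsilon_n^k)+h(z))$, $k\in[n]$, to (MP). (6) Set $t\gets t+1$. End while. Return the most recently computed master solution $(z^t,\lambda^t,\phi^t,\psi^t,\{\Theta_k^t\}_{k=1}^n)$. The accompanying description of the algorithm says that it terminates when the current master problem's optimal solution satisfies the newly generated cuts, and that alternatively one can also terminate it when the gap between the upper and lower bounds is within a pre-defined threshold.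
   Formalization: Exact optimality is claimed for returns through the test of newly generated cuts (the only exit if the threshold is negative); a return because the bound gap is within the threshold is only claimed to have value within the threshold of the optimum, as the tuple returned there violates a cut. *)

theory Defs
  imports "HOL-Analysis.Analysis"
begin

text \<open>
  The covariate \<open>x\<close>, the level \<open>\<alpha>\<close> and the sample are fixed throughout, so
  \<open>regr\<close> is the map \<open>z \<mapsto> f\<^sub>n(x,z)\<close> and \<open>radius\<close> is the number \<open>\<xi>\<^sub>n(\<alpha>,x)\<close>.
  Scenarios are the indices \<open>1, \<dots>, nsamp\<close>; families indexed by scenarios are functions on
  \<^typ>\<open>nat\<close> whose values at other indices are irrelevant.
  The index types are those of \<open>z\<close>, \<open>Y\<close>, \<open>\<omega>\<close> and of the \<open>M\<close> second-stage constraints.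
\<close>

record ('dz, 'dy, 'dw, 'm) problem =
  Zset   :: "(real ^ 'dz) set"
  nsamp  :: nat
  regr   :: "real ^ 'dz \<Rightarrow> real ^ 'dy"
  resid  :: "nat \<Rightarrow> real ^ 'dy"
  radius :: real
  cost1  :: "real ^ 'dz"
  cost2  :: "real ^ 'dw"
  Wmat   :: "real ^ 'dw ^ 'm"
  Tmat   :: "real ^ 'dz \<Rightarrow> real ^ 'dy ^ 'm"
  hvec   :: "real ^ 'dz \<Rightarrow> real ^ 'm"

definition affine_map :: "('a::real_vector \<Rightarrow> 'b::real_vector) \<Rightarrow> bool" where
  "affine_map f \<longleftrightarrow> (\<exists>L b. linear L \<and> f = (\<lambda>z. L z + b))"

definition scen :: "('dz::finite, 'dy::finite, 'dw::finite, 'm::finite) problem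
    \<Rightarrow> nat \<Rightarrow> real ^ 'dz \<Rightarrow> real ^ 'dy" where
  "scen D k z = regr D z + resid D k"

text \<open>The order \<open>\<le>\<close> on vectors is componentwise.\<close>

definition rhs :: "('dz::finite, 'dy::finite, 'dw::finite, 'm::finite) problem
    \<Rightarrow> real ^ 'dz \<Rightarrow> real ^ 'dy \<Rightarrow> real ^ 'm" where
  "rhs D z Y = Tmat D z *v Y + hvec D z"

definition recourse_region :: "('dz::finite, 'dy::finite, 'dw::finite, 'm::finite) problem
    \<Rightarrow> real ^ 'dz \<Rightarrow> real ^ 'dy \<Rightarrow> (real ^ 'dw) set" where
  "recourse_region D z Y = {\<omega>. rhs D z Y \<le> Wmat D *v \<omega>}"

text \<open>The minimum is attained when the second-stage problem and its dual are both feasible.\<close>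

definition Hval :: "('dz::finite, 'dy::finite, 'dw::finite, 'm::finite) problem
    \<Rightarrow> real ^ 'dz \<Rightarrow> real ^ 'dy \<Rightarrow> real" where
  "Hval D z Y = (LEAST v. v \<in> (\<lambda>\<omega>. cost2 D \<bullet> \<omega>) ` recourse_region D z Y)"

text \<open>Feasible region of the second-stage LP dual; it depends neither on \<open>z\<close> nor on \<open>Y\<close>.\<close>

definition dual_region :: "('dz::finite, 'dy::finite, 'dw::finite, 'm::finite) problem
    \<Rightarrow> (real ^ 'm) set" where
  "dual_region D = {\<pi>. 0 \<le> \<pi> \<and> transpose (Wmat D) *v \<pi> = cost2 D}"


text \<open>Tuples \<open>(z, \<lambda>, \<phi>, \<psi>)\<close>; row \<open>m\<close> of the matrix \<open>\<phi>\<close> is the vector \<open>\<phi>\<^sub>m\<close>.\<close>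

type_synonym ('dz, 'dy, 'dw) first =
  "(real ^ 'dz) \<times> real \<times> (real ^ 'dw ^ 'dy) \<times> (real ^ 'dw ^ 'dy)"

fun first_feasible :: "('dz::finite, 'dy::finite, 'dw::finite, 'm::finite) problem
    \<Rightarrow> ('dz, 'dy, 'dw) first \<Rightarrow> bool" where
  "first_feasible D (z, lam, phi, psi) \<longleftrightarrow>
     z \<in> Zset D \<and> 0 \<le> lam \<and>
     (\<forall>m. cost2 D \<bullet> (phi $ m) \<le> lam \<and> cost2 D \<bullet> (psi $ m) \<le> lam \<and>
          Tmat D z *v axis m 1 \<le> Wmat D *v (phi $ m) \<and>
          - (Tmat D z *v axis m 1) \<le> Wmat D *v (psi $ m))"

fun first_cost :: "('dz::finite, 'dy::finite, 'dw::finite, 'm::finite) problem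
    \<Rightarrow> ('dz, 'dy, 'dw) first \<Rightarrow> real" where
  "first_cost D (z, lam, phi, psi) = cost1 D \<bullet> z + lam * radius D"

fun P_feasible :: "('dz::finite, 'dy::finite, 'dw::finite, 'm::finite) problem
    \<Rightarrow> ('dz, 'dy, 'dw) first \<times> (nat \<Rightarrow> real ^ 'dw) \<Rightarrow> bool" where
  "P_feasible D (u, \<omega>) \<longleftrightarrow>
     first_feasible D u \<and>
     (\<forall>k\<in>{1..nsamp D}. \<omega> k \<in> recourse_region D (fst u) (scen D k (fst u)))"

fun P_value :: "('dz::finite, 'dy::finite, 'dw::finite, 'm::finite) problem
    \<Rightarrow> ('dz, 'dy, 'dw) first \<times> (nat \<Rightarrow> real ^ 'dw) \<Rightarrow> real" where
  "P_value D (u, \<omega>) = first_cost D u + 1 / real (nsamp D) * (\<Sum>k=1..nsamp D. cost2 D \<bullet> \<omega> k)"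

text \<open>
  Epigraph variables range over \<open>[-\<infinity>, \<infinity>)\<close>. In (P) they are bounded below by \<open>H\<close>, so
  they are real there. In the master problem \<open>-\<infinity>\<close> matters only as long as some \<open>\<Theta>\<^sub>k\<close> is
  not yet constrained: over the reals a master problem with an empty cut pool is unbounded
  and has no optimal solution, here it has one, of value \<open>-\<infinity>\<close>. If the master problem
  has an optimal solution with all \<open>\<Theta>\<^sub>k\<close> real, nothing changes.
\<close>

type_synonym ('dz, 'dy, 'dw) sol = "('dz, 'dy, 'dw) first \<times> (nat \<Rightarrow> ereal)"

fun theta_value :: "('dz::finite, 'dy::finite, 'dw::finite, 'm::finite) problem
    \<Rightarrow> ('dz, 'dy, 'dw) sol \<Rightarrow> ereal" where
  "theta_value D (u, \<Theta>) =
     ereal (first_cost D u) + ereal (1 / real (nsamp D)) * (\<Sum>k=1..nsamp D. \<Theta> k)"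

fun P_theta_feasible :: "('dz::finite, 'dy::finite, 'dw::finite, 'm::finite) problem
    \<Rightarrow> ('dz, 'dy, 'dw) sol \<Rightarrow> bool" where
  "P_theta_feasible D (u, \<Theta>) \<longleftrightarrow>
     first_feasible D u \<and>
     (\<forall>k\<in>{1..nsamp D}. \<Theta> k < \<infinity> \<and> ereal (Hval D (fst u) (scen D k (fst u))) \<le> \<Theta> k)"

text \<open>
  The returned tuple is optimal for the epigraph form, and its first-stage part extends to an
  optimal solution of the form with explicit recourse decisions.
\<close>

definition solves_P :: "('dz::finite, 'dy::finite, 'dw::finite, 'm::finite) problem
    \<Rightarrow> ('dz, 'dy, 'dw) sol \<Rightarrow> bool" where
  "solves_P D s \<longleftrightarrow>
     is_arg_min (theta_value D) (P_theta_feasible D) s \<and>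
     (\<exists>\<omega>. is_arg_min (P_value D) (P_feasible D) (fst s, \<omega>))"


text \<open>
  The initial pool consists of known bounds and cuts \<open>\<Theta>\<^sub>k \<ge> g(z)\<close>, \<open>g \<in> I k\<close>
  (constant \<open>g\<close> for a bound); it may be empty. Cuts generated by the algorithm for scenario
  \<open>k\<close> are stored as the set \<open>C k\<close> of their multipliers \<open>\<pi>\<close>.
\<close>

definition valid_pool :: "('dz::finite, 'dy::finite, 'dw::finite, 'm::finite) problem
    \<Rightarrow> (nat \<Rightarrow> (real ^ 'dz \<Rightarrow> real) set) \<Rightarrow> bool" where
  "valid_pool D I \<longleftrightarrow>
     (\<forall>k\<in>{1..nsamp D}. \<forall>g\<in>I k. \<forall>z\<in>Zset D. g z \<le> Hval D z (scen D k z))"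

definition cut :: "('dz::finite, 'dy::finite, 'dw::finite, 'm::finite) problem
    \<Rightarrow> nat \<Rightarrow> real ^ 'm \<Rightarrow> real ^ 'dz \<Rightarrow> real" where
  "cut D k \<pi> z = \<pi> \<bullet> rhs D z (scen D k z)"

fun master_feasible :: "('dz::finite, 'dy::finite, 'dw::finite, 'm::finite) problem
    \<Rightarrow> (nat \<Rightarrow> (real ^ 'dz \<Rightarrow> real) set) \<Rightarrow> (nat \<Rightarrow> (real ^ 'm) set)
    \<Rightarrow> ('dz, 'dy, 'dw) sol \<Rightarrow> bool" where
  "master_feasible D I C (u, \<Theta>) \<longleftrightarrow>
     first_feasible D u \<and>
     (\<forall>k\<in>{1..nsamp D}. \<Theta> k < \<infinity> \<and>
        (\<forall>g\<in>I k. ereal (g (fst u)) \<le> \<Theta> k) \<and>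
        (\<forall>\<pi>\<in>C k. ereal (cut D k \<pi> (fst u)) \<le> \<Theta> k))"

text \<open>
  A configuration \<open>Loop t LB UB C s\<close> is the state in front of the loop guard, where \<open>s\<close> is the
  most recent master solution. \<open>Return_cuts\<close> is the return after the test of the new cuts, \<open>Return_gap\<close> the one
  after the loop has been left because the guard \<open>UB - LB > \<epsilon>\<close> fails (never
  for a negative \<open>\<epsilon>\<close>, so that the test of the new cuts is then the only way to stop).
\<close>

datatype ('s, 'p) config =
    Loop nat ereal ereal "nat \<Rightarrow> 'p set" 's
  | Return_cuts 's
  | Return_gap 's

text \<open>
  \<open>mp t C\<close> is the answer of the master oracle in iteration \<open>t\<close> and \<open>sp t k z\<close> that of the
  subproblem solver for (SP\<open>\<^sup>k\<close>) at \<open>z\<close>. They may depend on \<open>t\<close>, so ties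
  may be broken differently in different iterations.
\<close>

fun benders_step :: "('dz::finite, 'dy::finite, 'dw::finite, 'm::finite) problem
    \<Rightarrow> (nat \<Rightarrow> (real ^ 'dz \<Rightarrow> real) set) \<Rightarrow> real
    \<Rightarrow> (nat \<Rightarrow> (nat \<Rightarrow> (real ^ 'm) set) \<Rightarrow> ('dz, 'dy, 'dw) sol)
    \<Rightarrow> (nat \<Rightarrow> nat \<Rightarrow> real ^ 'dz \<Rightarrow> real ^ 'm)
    \<Rightarrow> (('dz, 'dy, 'dw) sol, real ^ 'm) config \<Rightarrow> (('dz, 'dy, 'dw) sol, real ^ 'm) config" where
  "benders_step D I eps mp sp (Loop t LB UB C s) =
     (if UB - LB > ereal eps then
        let (u, \<Theta>) = mp t C;
            z = fst u;
            LB' = (INF s' \<in> Collect (master_feasible D I C). theta_value D s');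
            p = (\<lambda>k. sp t k z);
            UB' = min UB (ereal (first_cost D u
                    + 1 / real (nsamp D) * (\<Sum>k=1..nsamp D. p k \<bullet> rhs D z (scen D k z))))
        in if \<forall>k\<in>{1..nsamp D}. ereal (cut D k (p k) z) \<le> \<Theta> k
           then Return_cuts (u, \<Theta>)
           else Loop (t + 1) LB' UB' (\<lambda>k. insert (p k) (C k)) (u, \<Theta>)
      else Return_gap s)"
| "benders_step D I eps mp sp (Return_cuts s) = Return_cuts s"
| "benders_step D I eps mp sp (Return_gap s) = Return_gap s"

text \<open>
  Initially there is no master solution yet; the placeholder is never returned, because the
  initial gap is \<open>\<infinity>\<close> and the first iteration overwrites it.
\<close>

definition benders :: "('dz::finite, 'dy::finite, 'dw::finite, 'm::finite) problem
    \<Rightarrow> (nat \<Rightarrow> (real ^ 'dz \<Rightarrow> real) set) \<Rightarrow> real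
    \<Rightarrow> (nat \<Rightarrow> (nat \<Rightarrow> (real ^ 'm) set) \<Rightarrow> ('dz, 'dy, 'dw) sol)
    \<Rightarrow> (nat \<Rightarrow> nat \<Rightarrow> real ^ 'dz \<Rightarrow> real ^ 'm)
    \<Rightarrow> nat \<Rightarrow> (('dz, 'dy, 'dw) sol, real ^ 'm) config" where
  "benders D I eps mp sp i =
     (benders_step D I eps mp sp ^^ i) (Loop 1 (-\<infinity>) \<infinity> (\<lambda>_. {}) undefined)"

text \<open>The master oracle is required to be exact on the calls made during the run only.\<close>

definition master_oracle :: "('dz::finite, 'dy::finite, 'dw::finite, 'm::finite) problem
    \<Rightarrow> (nat \<Rightarrow> (real ^ 'dz \<Rightarrow> real) set) \<Rightarrow> real
    \<Rightarrow> (nat \<Rightarrow> (nat \<Rightarrow> (real ^ 'm) set) \<Rightarrow> ('dz, 'dy, 'dw) sol)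
    \<Rightarrow> (nat \<Rightarrow> nat \<Rightarrow> real ^ 'dz \<Rightarrow> real ^ 'm) \<Rightarrow> bool" where
  "master_oracle D I eps mp sp \<longleftrightarrow>
     (\<forall>i t LB UB C s. benders D I eps mp sp i = Loop t LB UB C s \<and> UB - LB > ereal eps \<longrightarrow>
        is_arg_min (theta_value D) (master_feasible D I C) (mp t C))"

definition extreme_point_solver :: "('dz::finite, 'dy::finite, 'dw::finite, 'm::finite) problem
    \<Rightarrow> (nat \<Rightarrow> nat \<Rightarrow> real ^ 'dz \<Rightarrow> real ^ 'm) \<Rightarrow> bool" where
  "extreme_point_solver D sp \<longleftrightarrow>
     (\<forall>t. \<forall>k\<in>{1..nsamp D}. \<forall>z\<in>Zset D.
        is_arg_max (\<lambda>\<pi>. \<pi> \<bullet> rhs D z (scen D k z)) (\<lambda>\<pi>. \<pi> \<in> dual_region D) (sp t k z) \<and>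
        sp t k z extreme_point_of dual_region D)"

end

theory Submission
  imports Defs
begin

text \<open>
  By LP duality, \<open>H(z, Y)\<close> is the maximum over the dual region \<open>\<Pi>\<close> of \<open>\<pi> \<bullet> (T(z) Y + h(z))\<close>. Hence every
  cut is valid, so each master problem is a relaxation of (P), and the cut generated at \<open>z\<^sup>t\<close> is
  tight there, so a master solution satisfying its new cuts is feasible, hence optimal, for (P).
  If it violates one, that multiplier is an extreme point of \<open>\<Pi>\<close> not yet in the pool of its
  scenario; as the polyhedron \<open>\<Pi>\<close> has finitely many extreme points, this happens finitely often.
\<close>

section \<open>Linear programming duality and the dual polyhedron\<close>

lemma lp_strong_duality:
  fixes W :: "real ^ 'w ^ 'm" and q :: "real ^ 'w" and r p :: "real ^ 'm"
  assumes opt: "is_arg_max (\<lambda>\<pi>. \<pi> \<bullet> r) (\<lambda>\<pi>. 0 \<le> \<pi> \<and> transpose W *v \<pi> = q) p"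
  shows "\<exists>\<omega>. r \<le> W *v \<omega> \<and> q \<bullet> \<omega> \<le> p \<bullet> r"
proof -
  text \<open>Farkas: \<open>K\<close> is generated by the finite set \<open>S\<close>, so a point outside of it can be separated
    strictly; the separating functional is an improving ray or a better point of the dual.\<close>
  define S where "S = range (\<lambda>j. (W *v axis j 1, q $ j)) \<union> range (\<lambda>j. (- (W *v axis j 1), - (q $ j)))
    \<union> range (\<lambda>i. (- axis i 1 :: real ^ 'm, 0)) \<union> {(0, 1 :: real)}"
  define K where "K = {(s, v). \<exists>\<omega>. s \<le> W *v \<omega> \<and> q \<bullet> \<omega> \<le> v}"
  have p: "0 \<le> p" "transpose W *v p = q"
    and p_max: "\<And>\<pi>. 0 \<le> \<pi> \<Longrightarrow> transpose W *v \<pi> = q \<Longrightarrow> \<pi> \<bullet> r \<le> p \<bullet> r"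
    using opt by (auto simp: is_arg_max_linorder)
  \<comment> \<open>A pair in \<open>K\<close> is a right-hand side with a budget that suffices for
    it. The columns of \<open>W\<close> enter \<open>S\<close> with both signs because
    \<open>\<omega>\<close> is free; the other generators are slack in the constraints and in the
    budget.\<close>
  have hull: "convex_cone hull S \<subseteq> K"
  proof (rule hull_minimal)
    have "(W *v axis j 1, q $ j) \<in> K" for j
      unfolding K_def by (auto intro!: exI[of _ "axis j 1"] simp: inner_axis)
    moreover have "(- (W *v axis j 1), - (q $ j)) \<in> K" for j
      unfolding K_def by (auto intro!: exI[of _ "- axis j 1"] simp: inner_axis
          matrix_vector_mult_def vec_eq_iff less_eq_vec_def sum_negf)
    moreover have "(- axis i 1, 0) \<in> K" for i
      unfolding K_def by (auto intro!: exI[of _ 0] simp: less_eq_vec_def axis_def)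
    moreover have "(0, 1) \<in> K"
      unfolding K_def by (auto intro!: exI[of _ 0] simp: zero_prod_def)
    ultimately show "S \<subseteq> K" unfolding S_def by blast
  next
    have "0 \<in> K" unfolding K_def by (auto intro!: exI[of _ 0] simp: zero_prod_def)
    moreover have "x + y \<in> K" if "x \<in> K" "y \<in> K" for x y
    proof -
      from that obtain s v s' v' \<omega> \<omega>' where *: "x = (s, v)" "y = (s', v')"
        "s \<le> W *v \<omega>" "q \<bullet> \<omega> \<le> v" "s' \<le> W *v \<omega>'" "q \<bullet> \<omega>' \<le> v'"
        unfolding K_def by auto
      then show ?thesis
        unfolding K_def using *
        by (auto intro!: exI[of _ "\<omega> + \<omega>'"] add_mono simp: matrix_vector_right_distrib inner_add_right
            less_eq_vec_def)
    qed
    moreover have "c *\<^sub>R x \<in> K" if "x \<in> K" "0 \<le> c" for x c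
    proof -
      from that obtain s v \<omega> where *: "x = (s, v)" "s \<le> W *v \<omega>" "q \<bullet> \<omega> \<le> v"
        unfolding K_def by auto
      then show ?thesis
        unfolding K_def using * \<open>0 \<le> c\<close>
        by (auto intro!: exI[of _ "c *\<^sub>R \<omega>"] mult_left_mono
            simp: matrix_vector_mult_scaleR less_eq_vec_def)
    qed
    ultimately show "convex_cone K" unfolding convex_cone_iff by blast
  qed
  have "(r, p \<bullet> r) \<in> convex_cone hull S"
  proof (rule ccontr)
    assume "(r, p \<bullet> r) \<notin> convex_cone hull S"
    moreover have "finite S" unfolding S_def by auto
    ultimately obtain a d where sep: "a \<bullet> (r, p \<bullet> r) < d" "\<And>x. x \<in> convex_cone hull S \<Longrightarrow> d < a \<bullet> x"
      using separating_hyperplane_closed_point[OF convex_convex_cone_hull closed_convex_cone_hull]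
      by metis
    obtain \<alpha> \<beta> where a: "a = (\<alpha>, \<beta>)" by force
    have "d < 0"
      using sep(2)[OF convex_cone_hull_contains_0] by simp
    have nonneg: "0 \<le> a \<bullet> x" if "x \<in> S" for x
    proof (rule ccontr)
      assume neg: "\<not> 0 \<le> a \<bullet> x"
      \<comment> \<open>The factor is positive and moves \<open>x\<close> onto the hyperplane at
        level \<open>d\<close>, where the strict separation fails.\<close>
      have "(d / (a \<bullet> x)) *\<^sub>R x \<in> convex_cone hull S"
        using that neg \<open>d < 0\<close>
        by (intro convex_cone_hull_mul hull_inc) (auto simp: divide_nonpos_neg)
      from sep(2)[OF this] show False using neg by simp
    qed
    have "0 \<le> \<beta>" using nonneg[of "(0, 1)"] by (simp add: S_def a)
    have \<alpha>: "\<alpha> $ i \<le> 0" for i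
      using nonneg[of "(- axis i 1, 0)"] by (simp add: S_def a inner_axis)
    have "\<alpha> \<bullet> (W *v axis j 1) + \<beta> * q $ j = 0" for j
      using nonneg[of "(W *v axis j 1, q $ j)"] nonneg[of "(- (W *v axis j 1), - (q $ j))"]
      by (simp add: S_def a)
    moreover have "\<alpha> \<bullet> (W *v axis j 1) = (transpose W *v \<alpha>) $ j" for j
      by (simp add: inner_axis flip: dot_lmul_matrix)
    \<comment> \<open>So \<open>- \<alpha>\<close> is nonnegative and solves the dual equation with
      \<open>q\<close> scaled by \<open>\<beta>\<close>: it can be added to \<open>p\<close> if
      \<open>\<beta> = 0\<close>, and divided by \<open>\<beta>\<close> it is itself a dual point
      otherwise.\<close>
    ultimately have W\<alpha>: "transpose W *v \<alpha> = - (\<beta> *\<^sub>R q)"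
      by (simp add: vec_eq_iff eq_neg_iff_add_eq_0)
    have r: "\<alpha> \<bullet> r + \<beta> * (p \<bullet> r) < 0"
      using sep(1) \<open>d < 0\<close> by (simp add: a)
    show False
    proof (cases "\<beta> = 0")
      case True
      have "(p - \<alpha>) \<bullet> r \<le> p \<bullet> r"
        using p W\<alpha> True \<alpha> by (intro p_max)
          (auto simp: less_eq_vec_def matrix_vector_mult_diff_distrib intro: order_trans)
      then show False using r True by (simp add: inner_diff_left)
    next
      case False
      with \<open>0 \<le> \<beta>\<close> have "0 < \<beta>" by simp
      have "transpose W *v ((- 1 / \<beta>) *\<^sub>R \<alpha>) = (- 1 / \<beta>) *\<^sub>R - (\<beta> *\<^sub>R q)"
        by (simp only: matrix_vector_mult_scaleR W\<alpha>)
      also have "\<dots> = q" using False by simp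
      finally have "((- 1 / \<beta>) *\<^sub>R \<alpha>) \<bullet> r \<le> p \<bullet> r"
        using \<open>0 < \<beta>\<close> \<alpha>
        by (intro p_max) (auto simp: less_eq_vec_def divide_nonpos_pos)
      then show False using r \<open>0 < \<beta>\<close> by (simp add: field_simps)
    qed
  qed
  then show ?thesis using hull unfolding K_def by auto
qed

text \<open>Weak duality: pairing with \<open>\<pi> \<ge> 0\<close> preserves the constraints on
  \<open>\<omega>\<close>, and the transposed matrix maps \<open>\<pi>\<close> to the cost
  vector.\<close>

lemma dual_bound:
  assumes "\<pi> \<in> dual_region D" "\<omega> \<in> recourse_region D z Y"
  shows "\<pi> \<bullet> rhs D z Y \<le> cost2 D \<bullet> \<omega>"
proof -
  have "\<pi> \<bullet> rhs D z Y \<le> \<pi> \<bullet> (Wmat D *v \<omega>)"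
    using assms unfolding dual_region_def recourse_region_def inner_vec_def less_eq_vec_def
    by (auto intro!: sum_mono mult_left_mono)
  also have "\<dots> = cost2 D \<bullet> \<omega>"
    using assms(1) by (auto simp: dual_region_def simp flip: dot_lmul_matrix)
  finally show ?thesis .
qed

text \<open>Weak and strong duality combined. Attainment is what gives the \<open>LEAST\<close> in
  \<open>Hval\<close> its meaning, as a set of reals need not have a least element.\<close>

lemma Hval_dual:
  assumes opt: "is_arg_max (\<lambda>\<pi>. \<pi> \<bullet> rhs D z Y) (\<lambda>\<pi>. \<pi> \<in> dual_region D) p"
  shows "Hval D z Y = p \<bullet> rhs D z Y"
    and "\<exists>\<omega>\<in>recourse_region D z Y. cost2 D \<bullet> \<omega> = Hval D z Y"
proof -
  have p: "p \<in> dual_region D" using opt by (simp add: is_arg_max_def)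
  obtain \<omega> where "rhs D z Y \<le> Wmat D *v \<omega>" "cost2 D \<bullet> \<omega> \<le> p \<bullet> rhs D z Y"
    using lp_strong_duality[of "rhs D z Y" "Wmat D" "cost2 D" p] opt
    by (auto simp: dual_region_def)
  then have \<omega>: "\<omega> \<in> recourse_region D z Y" "cost2 D \<bullet> \<omega> = p \<bullet> rhs D z Y"
    using dual_bound[OF p, of \<omega> z Y] by (auto simp: recourse_region_def)
  show H: "Hval D z Y = p \<bullet> rhs D z Y"
    unfolding Hval_def using \<omega> dual_bound[OF p, of _ z Y]
    by (intro Least_equality) (auto simp: image_iff intro!: bexI[of _ \<omega>])
  show "\<exists>\<omega>\<in>recourse_region D z Y. cost2 D \<bullet> \<omega> = Hval D z Y"
    using \<omega> H by auto
qed

text \<open>The region is cut out by finitely many half-spaces and hyperplanes, one for each index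
  of \<open>'m\<close> and of \<open>'dw\<close>.\<close>

lemma finite_extreme_points_dual_region:
  "finite {\<pi>. \<pi> extreme_point_of dual_region D}"
proof (rule finite_polyhedron_extreme_points)
  have "dual_region D = \<Inter> (range (\<lambda>i. {\<pi>. axis i 1 \<bullet> \<pi> \<ge> 0}))
      \<inter> \<Inter> (range (\<lambda>j. {\<pi>. transpose (Wmat D) $ j \<bullet> \<pi> = cost2 D $ j}))"
    by (auto simp: dual_region_def less_eq_vec_def inner_axis' vec_eq_iff
        matrix_vector_mul_component simp del: transpose_matrix_vector)
  then show "polyhedron (dual_region D)"
    by (auto intro!: polyhedron_Int polyhedron_Inter polyhedron_halfspace_ge polyhedron_hyperplane)
qed

text \<open>An infimum in \<open>ereal\<close>, so that bounds on it make sense before (P) is known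
  to have an optimal solution.\<close>

definition P_inf :: "('dz::finite, 'dy::finite, 'dw::finite, 'm::finite) problem \<Rightarrow> ereal" where
  "P_inf D = (INF s \<in> Collect (P_theta_feasible D). theta_value D s)"

lemma theta_value_mono:
  assumes "\<And>k. k \<in> {1..nsamp D} \<Longrightarrow> \<Theta> k \<le> \<Theta>' k"
  shows "theta_value D (u, \<Theta>) \<le> theta_value D (u, \<Theta>')"
  using assms by (auto intro!: add_left_mono ereal_mult_left_mono sum_mono)

lemma theta_value_real:
  "theta_value D (u, \<lambda>k. ereal (f k)) =
     ereal (first_cost D u + 1 / real (nsamp D) * (\<Sum>k=1..nsamp D. f k))"
  by simp

lemma is_arg_min_INF:
  fixes f :: "'a \<Rightarrow> 'b::complete_linorder"
  assumes "is_arg_min f P x"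
  shows "(INF y \<in> Collect P. f y) = f x"
  using assms by (intro antisym INF_lower INF_greatest) (auto simp: is_arg_min_linorder)

section \<open>Valid and tight cuts, and the master problem as a relaxation\<close>

locale benders_run =
  fixes D :: "('dz::finite, 'dy::finite, 'dw::finite, 'm::finite) problem"
    and I :: "nat \<Rightarrow> (real ^ 'dz \<Rightarrow> real) set"
    and eps :: real
    and mp :: "nat \<Rightarrow> (nat \<Rightarrow> (real ^ 'm) set) \<Rightarrow> ('dz, 'dy, 'dw) sol"
    and sp :: "nat \<Rightarrow> nat \<Rightarrow> real ^ 'dz \<Rightarrow> real ^ 'm"
  assumes pool: "valid_pool D I"
    and master: "master_oracle D I eps mp sp"
    and subproblems: "extreme_point_solver D sp"
begin

abbreviation scenarios :: "nat set" where
  "scenarios \<equiv> {1..nsamp D}"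

abbreviation vertices :: "(real ^ 'm) set" where
  "vertices \<equiv> {\<pi>. \<pi> extreme_point_of dual_region D}"

lemma sp_opt:
  assumes "k \<in> scenarios" "z \<in> Zset D"
  shows "is_arg_max (\<lambda>\<pi>. \<pi> \<bullet> rhs D z (scen D k z)) (\<lambda>\<pi>. \<pi> \<in> dual_region D) (sp t k z)"
    and "sp t k z \<in> vertices"
  using subproblems assms by (auto simp: extreme_point_solver_def)

text \<open>Tightness: strong duality at the very point \<open>z\<close> for which the multiplier
  was computed.\<close>

lemma cut_sp:
  assumes "k \<in> scenarios" "z \<in> Zset D"
  shows "cut D k (sp t k z) z = Hval D z (scen D k z)"
  using Hval_dual(1)[OF sp_opt(1)[OF assms]] by (simp add: cut_def)

lemma Hval_attained:
  assumes "k \<in> scenarios" "z \<in> Zset D"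
  obtains \<omega> where "\<omega> \<in> recourse_region D z (scen D k z)"
    "cost2 D \<bullet> \<omega> = Hval D z (scen D k z)"
  using Hval_dual(2)[OF sp_opt(1)[OF assms]] by blast

lemma Hval_le:
  assumes "k \<in> scenarios" "z \<in> Zset D" "\<omega> \<in> recourse_region D z (scen D k z)"
  shows "Hval D z (scen D k z) \<le> cost2 D \<bullet> \<omega>"
  using dual_bound[OF _ assms(3)] Hval_dual(1)[OF sp_opt(1)[OF assms(1,2)]] sp_opt(1)[OF assms(1,2)]
  by (metis is_arg_max_def)

text \<open>Validity: the dual region is the same for all \<open>z\<close>, so weak duality also
  applies to a multiplier computed at another point.\<close>

lemma cut_le_Hval:
  assumes "k \<in> scenarios" "z \<in> Zset D" "\<pi> \<in> dual_region D"
  shows "cut D k \<pi> z \<le> Hval D z (scen D k z)"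
  using dual_bound[OF assms(3)] Hval_attained[OF assms(1,2)] by (metis cut_def)

lemma first_feasible_Zset: "first_feasible D u \<Longrightarrow> fst u \<in> Zset D"
  by (cases u) auto

text \<open>Relaxation: \<open>valid_pool\<close> covers the constraints from \<open>I\<close>, weak
  duality those from \<open>C\<close>. This serves both the lower bound and the optimality of a
  solution that passes the test of its cuts.\<close>

lemma P_theta_imp_master:
  assumes C: "\<And>k. k \<in> scenarios \<Longrightarrow> C k \<subseteq> vertices"
    and "P_theta_feasible D s"
  shows "master_feasible D I C s"
proof (cases s)
  case (Pair u \<Theta>)
  have u: "first_feasible D u"
    and \<Theta>: "\<And>k. k \<in> scenarios \<Longrightarrow> \<Theta> k < \<infinity> \<and> ereal (Hval D (fst u) (scen D k (fst u))) \<le> \<Theta> k"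
    using assms(2) Pair by auto
  note z = first_feasible_Zset[OF u]
  have "ereal (g (fst u)) \<le> \<Theta> k" if "k \<in> scenarios" "g \<in> I k" for k g
  proof -
    have "g (fst u) \<le> Hval D (fst u) (scen D k (fst u))"
      using pool that z unfolding valid_pool_def by blast
    then show ?thesis using \<Theta>[OF that(1)] by (meson ereal_less_eq(3) order_trans)
  qed
  moreover have "ereal (cut D k \<pi> (fst u)) \<le> \<Theta> k" if "k \<in> scenarios" "\<pi> \<in> C k" for k \<pi>
  proof -
    have "\<pi> \<in> dual_region D"
      using C that unfolding extreme_point_of_def by blast
    then have "cut D k \<pi> (fst u) \<le> Hval D (fst u) (scen D k (fst u))"
      using that z by (intro cut_le_Hval)
    then show ?thesis using \<Theta>[OF that(1)] by (meson ereal_less_eq(3) order_trans)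
  qed
  ultimately show ?thesis using u \<Theta> Pair by auto
qed

lemma P_theta_feasible_recourse_cost:
  assumes "P_feasible D (u, \<omega>)"
  shows "P_theta_feasible D (u, \<lambda>k. ereal (cost2 D \<bullet> \<omega> k))"
  using assms first_feasible_Zset Hval_le by auto

lemma solves_P_if_cuts_hold:
  assumes opt: "is_arg_min (theta_value D) (master_feasible D I C) (u, \<Theta>)"
    and C: "\<And>k. k \<in> scenarios \<Longrightarrow> C k \<subseteq> vertices"
    and cuts: "\<And>k. k \<in> scenarios \<Longrightarrow> ereal (cut D k (sp t k (fst u)) (fst u)) \<le> \<Theta> k"
  shows "solves_P D (u, \<Theta>)"
proof -
  have u: "first_feasible D u" and \<Theta>: "\<And>k. k \<in> scenarios \<Longrightarrow> \<Theta> k < \<infinity>"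
    using opt by (auto simp: is_arg_min_def)
  note z = first_feasible_Zset[OF u]
  \<comment> \<open>By tightness, the new cuts at \<open>u\<close> say exactly that each
    \<open>\<Theta> k\<close> is at least the recourse value.\<close>
  have feas: "P_theta_feasible D (u, \<Theta>)"
    using u \<Theta> cuts by (auto simp: cut_sp[OF _ z])
  have min: "theta_value D (u, \<Theta>) \<le> theta_value D s" if "P_theta_feasible D s" for s
  proof -
    have "master_feasible D I C s" using C that by (rule P_theta_imp_master)
    then show ?thesis using opt unfolding is_arg_min_linorder by blast
  qed
  have "\<forall>k\<in>scenarios. \<exists>\<omega>. \<omega> \<in> recourse_region D (fst u) (scen D k (fst u)) \<and>
      cost2 D \<bullet> \<omega> = Hval D (fst u) (scen D k (fst u))"
    using Hval_attained[OF _ z] by metis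
  then obtain \<omega> where \<omega>: "\<And>k. k \<in> scenarios \<Longrightarrow> \<omega> k \<in> recourse_region D (fst u) (scen D k (fst u))"
      "\<And>k. k \<in> scenarios \<Longrightarrow> cost2 D \<bullet> \<omega> k = Hval D (fst u) (scen D k (fst u))"
    by metis
  \<comment> \<open>Replacing \<open>\<Theta>\<close> by optimal recourse costs at the same
    \<open>u\<close> cannot raise the value, so minimality passes from the epigraph form to the
    explicit form.\<close>
  have "P_value D (u, \<omega>) \<le> P_value D (u', \<omega>')" if "P_feasible D (u', \<omega>')" for u' \<omega>'
  proof -
    have "ereal (P_value D (u, \<omega>)) = theta_value D (u, \<lambda>k. ereal (cost2 D \<bullet> \<omega> k))"
      by (simp only: theta_value_real P_value.simps)
    also have "\<dots> \<le> theta_value D (u, \<Theta>)"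
      using feas by (intro theta_value_mono) (auto simp: \<omega>)
    also have "\<dots> \<le> theta_value D (u', \<lambda>k. ereal (cost2 D \<bullet> \<omega>' k))"
      by (rule min[OF P_theta_feasible_recourse_cost[OF that]])
    also have "\<dots> = ereal (P_value D (u', \<omega>'))"
      by (simp only: theta_value_real P_value.simps)
    finally show ?thesis by simp
  qed
  then have "is_arg_min (P_value D) (P_feasible D) (u, \<omega>)"
    using u \<omega>(1) unfolding is_arg_min_linorder by auto
  then show ?thesis
    using feas min unfolding solves_P_def is_arg_min_linorder by auto
qed

section \<open>Loop invariant, progress and termination\<close>

text \<open>Progress is counted in pairs of scenario and multiplier, since a multiplier new for one
  scenario may already be stored for another. The first alternative of the last clause covers the
  initial placeholder solution.\<close>

definition loop_inv :: "nat \<Rightarrow> ereal \<Rightarrow> ereal \<Rightarrow> (nat \<Rightarrow> (real ^ 'm) set) \<Rightarrow> ('dz, 'dy, 'dw) sol \<Rightarrow> bool" where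
  "loop_inv i LB UB C s \<longleftrightarrow>
     (\<forall>k\<in>scenarios. C k \<subseteq> vertices) \<and> i \<le> card (Sigma scenarios C) \<and>
     LB \<le> P_inf D \<and> P_inf D \<le> UB \<and>
     (LB = -\<infinity> \<and> UB = \<infinity> \<or> theta_value D s = LB \<and> UB < \<infinity>)"

text \<open>The conjunct \<open>0 \<le> eps\<close> is what later rules out the gap exit for a
  negative threshold.\<close>

fun config_inv :: "nat \<Rightarrow> (('dz, 'dy, 'dw) sol, real ^ 'm) config \<Rightarrow> bool" where
  "config_inv i (Loop t LB UB C s) \<longleftrightarrow> loop_inv i LB UB C s"
| "config_inv i (Return_cuts s) \<longleftrightarrow> solves_P D s"
| "config_inv i (Return_gap s) \<longleftrightarrow>
     theta_value D s \<le> P_inf D \<and> P_inf D \<le> theta_value D s + ereal eps \<and> 0 \<le> eps"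

lemma gap_exit:
  assumes inv: "loop_inv i LB UB C s" and gap: "\<not> UB - LB > ereal eps"
  shows "config_inv j (Return_gap s)"
proof -
  have LB: "LB \<le> P_inf D" "P_inf D \<le> UB" and s: "theta_value D s = LB" and "UB < \<infinity>"
    using inv gap by (auto simp: loop_inv_def)
  \<comment> \<open>Subtracting \<open>-\<infinity>\<close> gives the gap
    \<open>\<infinity>\<close>, which exceeds every real threshold. Hence both bounds are real at
    this exit.\<close>
  have "LB \<noteq> -\<infinity>" using gap by auto
  then obtain l where l: "LB = ereal l"
    using LB \<open>UB < \<infinity>\<close> by (cases LB) auto
  obtain b where b: "UB = ereal b"
    using LB \<open>UB < \<infinity>\<close> l by (cases UB) auto
  have "b \<le> l + eps" "l \<le> b"
    using gap LB l b by (auto simp: algebra_simps dest: order_trans)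
  then have "UB \<le> LB + ereal eps" "0 \<le> eps" by (auto simp: l b)
  then show ?thesis using LB s by (auto intro: order_trans)
qed

lemma new_cut_not_in_pool:
  assumes "master_feasible D I C (u, \<Theta>)" "k \<in> scenarios"
    and "\<not> ereal (cut D k \<pi> (fst u)) \<le> \<Theta> k"
  shows "\<pi> \<notin> C k"
  using assms by auto

lemma loop_inv_step:
  assumes inv: "loop_inv i LB UB C s"
    and opt: "is_arg_min (theta_value D) (master_feasible D I C) (u, \<Theta>)"
    and viol: "k \<in> scenarios" "\<not> ereal (cut D k (sp t k (fst u)) (fst u)) \<le> \<Theta> k"
  shows "loop_inv (Suc i) (INF s' \<in> Collect (master_feasible D I C). theta_value D s')
    (min UB (ereal (first_cost D u + 1 / real (nsamp D) *
       (\<Sum>k=1..nsamp D. sp t k (fst u) \<bullet> rhs D (fst u) (scen D k (fst u))))))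
    (\<lambda>k. insert (sp t k (fst u)) (C k)) (u, \<Theta>)"
    (is "loop_inv _ ?LB (min UB ?ub) ?C _")
proof -
  have C: "\<And>k. k \<in> scenarios \<Longrightarrow> C k \<subseteq> vertices" and card: "i \<le> card (Sigma scenarios C)"
    and UB: "P_inf D \<le> UB"
    using inv by (auto simp: loop_inv_def)
  have feas: "master_feasible D I C (u, \<Theta>)" using opt by (simp add: is_arg_min_def)
  then have u: "first_feasible D u" by simp
  note z = first_feasible_Zset[OF u]
  have C': "\<forall>k\<in>scenarios. ?C k \<subseteq> vertices" using C sp_opt(2)[OF _ z] by blast
  have "finite (Sigma scenarios ?C)"
    using C' finite_subset[OF _ finite_extreme_points_dual_region] by (intro finite_SigmaI) blast+
  \<comment> \<open>One violated scenario makes the inclusion strict; the others may regenerate old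
    multipliers.\<close>
  moreover have "Sigma scenarios C \<subset> Sigma scenarios ?C"
    using viol new_cut_not_in_pool[OF feas viol] by blast
  ultimately have "card (Sigma scenarios C) < card (Sigma scenarios ?C)"
    by (rule psubset_card_mono)
  with card have card': "Suc i \<le> card (Sigma scenarios ?C)" by linarith
  have LB: "?LB \<le> P_inf D"
    unfolding P_inf_def by (rule INF_superset_mono) (use P_theta_imp_master[OF C] in auto)
  \<comment> \<open>With the true recourse values as epigraph variables, the master's
    \<open>u\<close> is feasible for (P); by tightness its value is the new candidate for
    \<open>UB\<close>.\<close>
  let ?\<Theta> = "\<lambda>k. ereal (Hval D (fst u) (scen D k (fst u)))"
  have "P_inf D \<le> theta_value D (u, ?\<Theta>)"
    unfolding P_inf_def using u by (intro INF_lower) auto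
  also have "\<dots> = ?ub"
    unfolding theta_value_real using cut_sp[OF _ z] by (simp add: cut_def)
  finally have "P_inf D \<le> min UB ?ub" using UB by simp
  moreover have "min UB ?ub < \<infinity>" unfolding min_less_iff_disj by simp
  ultimately show ?thesis
    using C' card' LB is_arg_min_INF[OF opt, symmetric] unfolding loop_inv_def by blast
qed

lemma benders_inv: "config_inv i (benders D I eps mp sp i)"
proof (induction i)
  case 0
  show ?case by (simp add: benders_def loop_inv_def)
next
  case (Suc i)
  have step: "benders D I eps mp sp (Suc i) = benders_step D I eps mp sp (benders D I eps mp sp i)"
    by (simp add: benders_def)
  show ?case
  proof (cases "benders D I eps mp sp i")
    case (Loop t LB UB C s)
    then have inv: "loop_inv i LB UB C s" using Suc by simp
    show ?thesis
    proof (cases "UB - LB > ereal eps")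
      case False
      then show ?thesis using gap_exit[OF inv] by (simp add: step Loop)
    next
      case True
      obtain u \<Theta> where m: "mp t C = (u, \<Theta>)" by (rule prod.exhaust)
      \<comment> \<open>Exactness of the oracle is available here because this configuration is
        reached by the run and its guard holds.\<close>
      have opt: "is_arg_min (theta_value D) (master_feasible D I C) (u, \<Theta>)"
        using master Loop True m unfolding master_oracle_def by metis
      have C: "\<And>k. k \<in> scenarios \<Longrightarrow> C k \<subseteq> vertices"
        using inv by (auto simp: loop_inv_def)
      show ?thesis
      proof (cases "\<forall>k\<in>scenarios. ereal (cut D k (sp t k (fst u)) (fst u)) \<le> \<Theta> k")
        case cuts: True
        then show ?thesis
          using True solves_P_if_cuts_hold[OF opt C, of t] by (simp add: step Loop m Let_def)
      next
        case False
        then obtain k where "k \<in> scenarios" "\<not> ereal (cut D k (sp t k (fst u)) (fst u)) \<le> \<Theta> k"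
          by blast
        from loop_inv_step[OF inv opt this] show ?thesis
          unfolding step Loop benders_step.simps Let_def m prod.case if_P[OF True] if_not_P[OF False]
          by simp
      qed
    qed
  qed (use Suc step in auto)
qed

lemma benders_terminates: "\<exists>N s. benders D I eps mp sp N \<in> {Return_cuts s, Return_gap s}"
proof -
  \<comment> \<open>One more step than there are pairs of a scenario and a vertex.\<close>
  let ?N = "Suc (card (scenarios \<times> vertices))"
  have False if "benders D I eps mp sp ?N = Loop t LB UB C s" for t LB UB C s
  proof -
    have inv: "loop_inv ?N LB UB C s" using benders_inv[of ?N] that by simp
    then have "Sigma scenarios C \<subseteq> scenarios \<times> vertices"
      unfolding loop_inv_def by blast
    then have "card (Sigma scenarios C) \<le> card (scenarios \<times> vertices)"
      using finite_extreme_points_dual_region by (intro card_mono) auto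
    then show False using inv by (simp add: loop_inv_def)
  qed
  then show ?thesis
    by (cases "benders D I eps mp sp ?N") (auto intro!: exI[of _ ?N])
qed

end

theorem theorem4p5:
  fixes D :: "('dz::finite, 'dy::finite, 'dw::finite, 'm::finite) problem"
    and I :: "nat \<Rightarrow> (real ^ 'dz \<Rightarrow> real) set"
    and eps :: real
    and mp :: "nat \<Rightarrow> (nat \<Rightarrow> (real ^ 'm) set) \<Rightarrow> ('dz, 'dy, 'dw) sol"
    and sp :: "nat \<Rightarrow> nat \<Rightarrow> real ^ 'dz \<Rightarrow> real ^ 'm"
  assumes Z: "Zset D \<noteq> {}" "compact (Zset D)"
    and n: "nsamp D \<ge> 1"
    and radius: "radius D \<ge> 0"
    and affine: "affine_map (Tmat D)" "affine_map (hvec D)"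
    and complete_recourse: "\<forall>z\<in>Zset D. \<forall>Y. recourse_region D z Y \<noteq> {}"
    and expensive_recourse: "dual_region D \<noteq> {}"
    and pool: "valid_pool D I"
    and master: "master_oracle D I eps mp sp"
    and subproblems: "extreme_point_solver D sp"
  shows
    \<comment> \<open>the algorithm stops after finitely many iterations\<close>
    "(\<exists>N s. benders D I eps mp sp N \<in> {Return_cuts s, Return_gap s}) \<and>
    \<comment> \<open>a tuple that satisfies its newly generated cuts is optimal for (P)\<close>
     (\<forall>N s. benders D I eps mp sp N = Return_cuts s \<longrightarrow> solves_P D s) \<and>
    \<comment> \<open>if the gap test is switched off by a negative threshold, this is how it stops\<close>
     (eps < 0 \<longrightarrow> (\<exists>N s. benders D I eps mp sp N = Return_cuts s \<and> solves_P D s)) \<and>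
    \<comment> \<open>on the gap exit, the returned value is optimal within the threshold\<close>
     (\<forall>N s. benders D I eps mp sp N = Return_gap s \<longrightarrow>
        (let v = (INF s' \<in> Collect (P_theta_feasible D). theta_value D s')
         in theta_value D s \<le> v \<and> v \<le> theta_value D s + ereal eps))"
proof -
  interpret benders_run D I eps mp sp
    using pool master subproblems by unfold_locales
  have cuts: "solves_P D s" if "benders D I eps mp sp N = Return_cuts s" for N s
    using benders_inv[of N] that by simp
  have gap: "theta_value D s \<le> P_inf D \<and> P_inf D \<le> theta_value D s + ereal eps \<and> 0 \<le> eps"
    if "benders D I eps mp sp N = Return_gap s" for N s
    using benders_inv[of N] that by simp
  obtain N s where "benders D I eps mp sp N \<in> {Return_cuts s, Return_gap s}"
    using benders_terminates by blast
  \<comment> \<open>The gap exit would force \<open>0 \<le> eps\<close>.\<close>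
  moreover from this have "eps < 0 \<Longrightarrow> benders D I eps mp sp N = Return_cuts s"
    using gap by fastforce
  ultimately show ?thesis
    using cuts gap unfolding P_inf_def Let_def by blast
qed

end
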